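(* Let $\mathbf{y}_1,\dots,\mathbf{y}_s\in\mathbb{C}^n$ be pairwise linearly independent. If $k$ is sufficiently large, then the symmetric tensor defined by $A:=\sum_{i=1}^{s}\mathbf{y}_i^{\otimes k}$ satisfies $\operatorname{rank}(A)=\operatorname{rank}_{\mathsf{S}}(A)$ generically.
   Context: $\mathsf{T}^k(\mathbb{C}^n)=\mathbb{C}^n\otimes\cdots\otimes\mathbb{C}^n$ ($k$ copies), and $\mathsf{S}^k(\mathbb{C}^n)$ is its subspace of symmetric tensors (those invariant under all permutations of the $k$ tensor factors). For $\mathbf{y}\in\mathbb{C}^n$, $\mathbf{y}^{\otimes k}=\mathbf{y}\otimes\cdots\otimes\mathbf{y}$ ($k$ copies). For $A\in\mathsf{T}^k(\mathbb{C}^n)$, $\operatorname{rank}(A)$ is the least $r$ such that $A=\sum_{i=1}^r \mathbf{u}_i^{(1)}\otimes\cdots\otimes\mathbf{u}_i^{(k)}$ with $\mathbf{u}_i^{(j)}\in\mathbb{C}^n$. For $A\in\mathsf{S}^k(\mathbb{C}^n)$, $\operatorname{rank}_{\mathsf{S}}(A)$ is the least $t$ such that $A=\sum_{i=1}^t\mathbf{z}_i^{\otimes k}$ with $\mathbf{z}_i\in\mathbb{C}^n$. Roughly speaking, a property is called generic if it is true almost everywhere. *)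

theory Defs
  imports "HOL-Analysis.Analysis" "HOL-Combinatorics.Combinatorics"
begin

text \<open>
  Since the order k varies while n is fixed, a tensor of order k over \<open>complex ^ 'n\<close> is given by
  its coordinates: a function on multi-indices (lists over \<open>'n\<close>), vanishing on all
  lists whose length is not k.
\<close>

definition tensors :: "nat \<Rightarrow> ('n::finite list \<Rightarrow> complex) set" where
  "tensors k = {A. \<forall>is. length is \<noteq> k \<longrightarrow> A is = 0}"

definition sym_tensors :: "nat \<Rightarrow> ('n::finite list \<Rightarrow> complex) set" where
  "sym_tensors k = {A \<in> tensors k. \<forall>\<sigma> is. \<sigma> permutes {..<k} \<and> length is = k
     \<longrightarrow> A (permute_list \<sigma> is) = A is}"

text \<open>Coordinates of the tensor product of \<open>u 0, \<dots>, u (k - 1)\<close>.\<close>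

definition tensor_prod :: "nat \<Rightarrow> (nat \<Rightarrow> complex ^ 'n) \<Rightarrow> 'n::finite list \<Rightarrow> complex" where
  "tensor_prod k u is = (if length is = k then \<Prod>j<k. u j $ (is ! j) else 0)"

definition tensor_pow :: "nat \<Rightarrow> complex ^ 'n \<Rightarrow> 'n::finite list \<Rightarrow> complex" where
  "tensor_pow k z = tensor_prod k (\<lambda>_. z)"

definition tensor_rank :: "nat \<Rightarrow> ('n::finite list \<Rightarrow> complex) \<Rightarrow> nat" where
  "tensor_rank k A =
     (LEAST r. \<exists>u :: nat \<Rightarrow> nat \<Rightarrow> complex ^ 'n. A = (\<lambda>is. \<Sum>i<r. tensor_prod k (u i) is))"

text \<open>Meaningful for \<open>A \<in> sym_tensors k\<close> only: other tensors are not sums of k-th powers.\<close>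

definition sym_rank :: "nat \<Rightarrow> ('n::finite list \<Rightarrow> complex) \<Rightarrow> nat" where
  "sym_rank k A =
     (LEAST t. \<exists>z :: nat \<Rightarrow> complex ^ 'n. A = (\<lambda>is. \<Sum>i<t. tensor_pow k (z i) is))"

text \<open>The conjunct \<open>y $ i \<noteq> y $ j\<close> is needed because \<open>{v, v}\<close> collapses to the singleton \<open>{v}\<close>.\<close>

definition pairwise_lin_indep :: "complex ^ 'n ^ 's \<Rightarrow> bool" where
  "pairwise_lin_indep y \<longleftrightarrow>
     (\<forall>i j. i \<noteq> j \<longrightarrow> y $ i \<noteq> y $ j \<and> vec.independent {y $ i, y $ j})"

definition power_sum_tensor :: "nat \<Rightarrow> complex ^ 'n ^ 's \<Rightarrow> 'n::finite list \<Rightarrow> complex" where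
  "power_sum_tensor k y = (\<lambda>is. \<Sum>i\<in>UNIV. tensor_pow k (y $ i) is)"

lemma power_sum_tensor_sym: "power_sum_tensor k y \<in> sym_tensors k"
proof -
  have "(\<Prod>j<k. z $ (permute_list \<sigma> is ! j)) = (\<Prod>j<k. z $ (is ! j))"
    if \<sigma>: "\<sigma> permutes {..<k}" and len: "length is = k"
    for z :: "complex ^ 'a" and \<sigma> "is"
  proof -
    have "(\<Prod>j<k. z $ (permute_list \<sigma> is ! j)) = (\<Prod>j<k. z $ (is ! \<sigma> j))"
      using \<sigma> len by (intro prod.cong) (auto simp: permute_list_nth)
    also have "\<dots> = (\<Prod>j<k. z $ (is ! j))"
      using prod.permute[OF \<sigma>, of "\<lambda>j. z $ (is ! j)"] by (simp add: o_def)
    finally show ?thesis .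
  qed
  then show ?thesis
    by (auto simp: power_sum_tensor_def sym_tensors_def tensors_def tensor_pow_def
        tensor_prod_def intro!: sum.cong)
qed

text \<open>Complex polynomial functions in the coordinates of the space of s-tuples of n-vectors.\<close>

inductive polynomial_fun :: "(complex ^ 'n ^ 's \<Rightarrow> complex) \<Rightarrow> bool" where
  const: "polynomial_fun (\<lambda>_. c)"
| coord: "polynomial_fun (\<lambda>y. y $ i $ j)"
| add: "polynomial_fun p \<Longrightarrow> polynomial_fun q \<Longrightarrow> polynomial_fun (\<lambda>y. p y + q y)"
| mult: "polynomial_fun p \<Longrightarrow> polynomial_fun q \<Longrightarrow> polynomial_fun (\<lambda>y. p y * q y)"

text \<open>
  Genericity in the sense of the Zariski topology: P holds on a nonempty (hence dense) Zariski
  open set. Principal open sets form a base, so one polynomial suffices. The exceptional set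
  lies in the zero set of a nonzero polynomial and so is Lebesgue null: P holds almost everywhere.
\<close>

definition generically :: "(complex ^ 'n ^ 's \<Rightarrow> bool) \<Rightarrow> bool" where
  "generically P \<longleftrightarrow>
     (\<exists>p. polynomial_fun p \<and> (\<exists>y. p y \<noteq> 0) \<and> (\<forall>y. p y \<noteq> 0 \<longrightarrow> P y))"

end

theory Submission imports Defs begin

text \<open>
  The two ranks agree for every pairwise linearly independent family, with \<open>k \<ge> 2 s\<close>: apart from
  a degenerate case, both equal \<open>s\<close>. The defining sum shows that both are at most \<open>s\<close>, so the
  point is that no decomposition into product tensors has fewer than \<open>s\<close> terms.

  This is the flattening argument. Pairwise independence provides for \<open>i \<noteq> l\<close> a linear form that
  kills \<open>y\<^sub>l\<close> but not \<open>y\<^sub>i\<close> (\<open>separating_form\<close>). The product over all \<open>l\<close> of such forms is a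
  functional \<open>\<phi>\<^sub>i\<close> on tensors of order \<open>s\<close> that vanishes on every \<open>y\<^sub>m\<^sup>\<otimes>\<^sup>s\<close> with \<open>m \<noteq> i\<close> and not on
  \<open>y\<^sub>i\<^sup>\<otimes>\<^sup>s\<close>. Since \<open>k \<ge> 2 s\<close>, one such functional fits on the first \<open>s\<close> tensor factors and another
  on the remaining ones, and evaluating \<open>A\<close> at all pairs of them gives an invertible diagonal
  \<open>s \<times> s\<close> matrix. A product tensor contributes a matrix of rank at most one, so at least \<open>s\<close> of
  them are needed (\<open>card_le_decomposition_length\<close>).

  In the degenerate case some \<open>y\<^sub>i\<close> is zero. Then \<open>s = 1\<close>, the tensor is zero, and both ranks are
  zero. Hence the Zariski open set may be taken to be the whole space.
\<close>

section \<open>Contraction with a product of linear forms\<close>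

definition linear_form :: "complex ^ 'n \<Rightarrow> complex ^ 'n::finite \<Rightarrow> complex" where
  "linear_form g x = (\<Sum>i\<in>UNIV. g $ i * x $ i)"

definition contraction ::
    "nat \<Rightarrow> (nat \<Rightarrow> complex ^ 'n) \<Rightarrow> ('n::finite list \<Rightarrow> complex) \<Rightarrow> complex" where
  "contraction k g A = (\<Sum>is | length is = k. A is * (\<Prod>t<k. g t $ (is ! t)))"

lemma sum_lists_prod:
  fixes F :: "nat \<Rightarrow> 'n::finite \<Rightarrow> 'c::comm_semiring_1"
  shows "(\<Sum>is | length is = k. \<Prod>t<k. F t (is ! t)) = (\<Prod>t<k. \<Sum>i\<in>UNIV. F t i)"
proof (induction k arbitrary: F)
  case 0
  then show ?case by simp
next
  case (Suc k)
  have lists: "{is :: 'n list. length is = Suc k} = (\<lambda>(i, is). i # is) ` (UNIV \<times> {is. length is = k})"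
    by (auto simp: length_Suc_conv image_iff)
  have inj: "inj_on (\<lambda>(i, is). i # is) (UNIV \<times> {is :: 'n list. length is = k})"
    by (auto simp: inj_on_def)
  have "(\<Sum>is | length is = Suc k. \<Prod>t<Suc k. F t (is ! t))
      = (\<Sum>(i, is)\<in>UNIV \<times> {is. length is = k}. F 0 i * (\<Prod>t<k. F (Suc t) (is ! t)))"
    unfolding lists by (subst sum.reindex[OF inj])
      (simp add: prod.lessThan_Suc_shift case_prod_unfold del: prod.lessThan_Suc)
  also have "\<dots> = (\<Sum>i\<in>UNIV. F 0 i) * (\<Sum>is | length is = k. \<Prod>t<k. F (Suc t) (is ! t))"
    by (simp add: sum_product sum.cartesian_product)
  also have "\<dots> = (\<Prod>t<Suc k. \<Sum>i\<in>UNIV. F t i)"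
    by (simp add: Suc.IH[of "\<lambda>t. F (Suc t)"] prod.lessThan_Suc_shift del: prod.lessThan_Suc)
  finally show ?case .
qed

lemma contraction_tensor_prod:
  "contraction k g (tensor_prod k u) = (\<Prod>t<k. linear_form (g t) (u t))"
proof -
  have "contraction k g (tensor_prod k u)
      = (\<Sum>is | length is = k. \<Prod>t<k. g t $ (is ! t) * u t $ (is ! t))"
    unfolding contraction_def
    by (intro sum.cong) (auto simp: tensor_prod_def prod.distrib mult.commute)
  then show ?thesis
    unfolding linear_form_def by (simp add: sum_lists_prod[of "\<lambda>t i. g t $ i * u t $ i"])
qed

lemma contraction_sum:
  "contraction k g (\<lambda>is. \<Sum>i\<in>I. T i is) = (\<Sum>i\<in>I. contraction k g (T i))"
  unfolding contraction_def sum_distrib_right by (rule sum.swap)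

section \<open>Separating pairwise independent vectors\<close>

lemma linear_form_nonzero:
  assumes "v \<noteq> 0"
  obtains g where "linear_form g v \<noteq> 0"
proof -
  from assms obtain a where "v $ a \<noteq> 0" by (auto simp: vec_eq_iff)
  then have "linear_form (axis a 1) v \<noteq> 0"
    by (simp add: linear_form_def axis_def if_distrib[of "\<lambda>x. x * _"] cong: if_cong)
  then show ?thesis using that by blast
qed

text \<open>
  If no form separates \<open>v\<close> from \<open>w\<close>, then in particular the forms \<open>x \<mapsto> w\<^sub>b x\<^sub>a - w\<^sub>a x\<^sub>b\<close>, which vanish
  at \<open>w\<close>, all vanish at \<open>v\<close>; with \<open>w\<^sub>b \<noteq> 0\<close> this makes \<open>v\<close> a multiple of \<open>w\<close>.
\<close>
lemma separating_form:
  fixes v w :: "complex ^ 'n::finite"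
  assumes indep: "vec.independent {v, w}" and ne: "v \<noteq> w"
  obtains g where "linear_form g v \<noteq> 0" "linear_form g w = 0"
proof -
  have "w \<noteq> 0" using indep vec.dependent_zero[of "{v, w}"] by auto
  then obtain b where b: "w $ b \<noteq> 0" by (auto simp: vec_eq_iff)
  define g where "g a = (w $ b) *s axis a 1 - (w $ a) *s axis b 1" for a
  have g: "linear_form (g a) x = w $ b * x $ a - w $ a * x $ b" for a x
    by (simp add: linear_form_def g_def axis_def left_diff_distrib sum_subtractf
        if_distrib[of "\<lambda>x. x * _"] if_distrib[of "\<lambda>x. _ * x"] cong: if_cong)
  have "\<exists>a. linear_form (g a) v \<noteq> 0"
  proof (rule ccontr)
    assume "\<not> ?thesis"
    then have "v = (v $ b / w $ b) *s w"
      using b by (simp add: g vec_eq_iff field_simps)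
    then have "v \<in> vec.span {w}"
      by (metis vec.span_base vec.span_scale singletonI)
    moreover have "v \<notin> vec.span {w}"
      using indep ne vec.independent_insert[of v "{w}"] by simp
    ultimately show False by simp
  qed
  moreover have "linear_form (g a) w = 0" for a
    by (simp add: g)
  ultimately show ?thesis using that by blast
qed

section \<open>The lower bound for the rank\<close>

text \<open>
  With functionals \<open>\<phi>\<^sub>i\<close> on the first \<open>s\<close> factors and \<open>\<psi>\<^sub>j\<close> on the rest, the matrix
  \<open>(\<phi>\<^sub>i \<otimes> \<psi>\<^sub>j)(A)\<close> is diagonal without zeros on the diagonal. On the other hand each of its columns is
  a combination of the \<open>r\<close> vectors \<open>v\<^sub>m = (\<phi>\<^sub>i(u\<^sub>m))\<^sub>i\<close>, one for each term of the decomposition. So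
  these vectors span the space of dimension \<open>s\<close>.
\<close>
lemma card_le_decomposition_length:
  fixes y :: "complex ^ 'n::finite ^ 's::finite"
  assumes indep: "pairwise_lin_indep y" and nz: "\<And>i. y $ i \<noteq> 0"
    and k: "2 * CARD('s) \<le> k"
    and A: "power_sum_tensor k y = (\<lambda>is. \<Sum>m<r. tensor_prod k (u m) is)"
  shows "CARD('s) \<le> r"
proof -
  let ?s = "CARD('s)"
  have "\<exists>g. linear_form g (y $ i) \<noteq> 0 \<and> (l \<noteq> i \<longrightarrow> linear_form g (y $ l) = 0)" for i l
  proof (cases "l = i")
    case True
    then show ?thesis using linear_form_nonzero[OF nz] by metis
  next
    case False
    then show ?thesis
      using indep separating_form[of "y $ i" "y $ l"] unfolding pairwise_lin_indep_def by metis
  qed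
  then obtain g where g1: "\<And>i l. linear_form (g i l) (y $ i) \<noteq> 0"
    and g0: "\<And>i l. l \<noteq> i \<Longrightarrow> linear_form (g i l) (y $ l) = 0"
    by metis
  obtain e :: "nat \<Rightarrow> 's" where e: "bij_betw e {..<?s} UNIV"
    using ex_bij_betw_nat_finite[of "UNIV :: 's set"]
    by (auto simp: atLeast0LessThan)
  have e_onto: "\<exists>t<?s. e t = l" for l
    using e unfolding bij_betw_def by (metis UNIV_I imageE lessThan_iff)
  \<comment> \<open>The functional of index \<open>i\<close> occupies the first \<open>s\<close> factors, the one of index \<open>j\<close> the others.
    From position \<open>2 s\<close> on, the values of \<open>e\<close> do not matter: no form \<open>g j l\<close> kills \<open>y\<^sub>j\<close>.\<close>
  define h where "h i j t = (if t < ?s then g i (e t) else g j (e (t - ?s)))" for i j t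
  define L where "L i w = (\<Prod>t<?s. linear_form (g i (e t)) (w t))" for i w
  define R where "R j w = (\<Prod>t\<in>{?s..<k}. linear_form (g j (e (t - ?s))) (w t))" for j w
  have split: "contraction k (h i j) (tensor_prod k w) = L i w * R j w" for i j w
  proof -
    have range: "{..<k} = {..<?s} \<union> {?s..<k}" using k by auto
    have "contraction k (h i j) (tensor_prod k w)
        = (\<Prod>t<?s. linear_form (h i j t) (w t)) * (\<Prod>t\<in>{?s..<k}. linear_form (h i j t) (w t))"
      unfolding contraction_tensor_prod range by (rule prod.union_disjoint) auto
    then show ?thesis by (simp add: h_def L_def R_def)
  qed
  have L: "L i (\<lambda>_. y $ m) = 0 \<longleftrightarrow> m \<noteq> i" for i m
    unfolding L_def using g0 g1 e_onto[of m] by auto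
  have R: "R j (\<lambda>_. y $ m) = 0 \<longleftrightarrow> m \<noteq> j" for j m
  proof -
    obtain t where "t < ?s" "e t = m" using e_onto by blast
    then have "?s + t \<in> {?s..<k}" "e (?s + t - ?s) = m" using k by auto
    then show ?thesis
      unfolding R_def prod_zero_iff[OF finite_atLeastLessThan] using g0 g1 by metis
  qed
  define v where "v m = (\<chi> i. L i (u m))" for m
  have "axis j 1 \<in> vec.span (v ` {..<r})" for j
  proof -
    define d where "d = L j (\<lambda>_. y $ j) * R j (\<lambda>_. y $ j)"
    have d: "d \<noteq> 0" using L R by (simp add: d_def)
    have "(\<Sum>m<r. R j (u m) *s v m) = d *s axis j 1"
    proof -
      have "(\<Sum>m<r. L i (u m) * R j (u m)) = (if i = j then d else 0)" for i
      proof -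
        have "(\<Sum>m<r. L i (u m) * R j (u m)) = contraction k (h i j) (power_sum_tensor k y)"
          by (simp add: A contraction_sum split)
        also have "\<dots> = (\<Sum>m\<in>UNIV. L i (\<lambda>_. y $ m) * R j (\<lambda>_. y $ m))"
          by (simp add: power_sum_tensor_def tensor_pow_def contraction_sum split)
        also have "\<dots> = (\<Sum>m\<in>UNIV. if m = j then (if i = j then d else 0) else 0)"
          using L R by (intro sum.cong) (auto simp: d_def)
        finally show ?thesis by simp
      qed
      then show ?thesis by (simp add: vec_eq_iff v_def axis_def mult.commute)
    qed
    then have "axis j 1 = (1 / d) *s (\<Sum>m<r. R j (u m) *s v m)"
      using d by (simp add: vec_eq_iff)
    then show ?thesis
      by (auto intro!: vec.span_scale vec.span_sum intro: vec.span_base)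
  qed
  then have "x \<in> vec.span (v ` {..<r})" for x :: "complex ^ 's"
    by (subst basis_expansion[of x, symmetric]) (auto intro!: vec.span_sum vec.span_scale)
  then have "vec.dim (UNIV :: (complex ^ 's) set) \<le> card (v ` {..<r})"
    by (intro vec.dim_le_card) auto
  also have "\<dots> \<le> r" using card_image_le[of "{..<r}" v] by simp
  finally show ?thesis by (simp only: vec_dim_card)
qed

section \<open>Equality of the ranks\<close>

lemma power_sum_tensor_enumerated:
  fixes y :: "complex ^ 'n::finite ^ 's::finite"
  obtains z where "power_sum_tensor k y = (\<lambda>is. \<Sum>i<CARD('s). tensor_pow k (z i) is)"
proof -
  obtain e :: "nat \<Rightarrow> 's" where e: "bij_betw e {..<CARD('s)} UNIV"
    using ex_bij_betw_nat_finite[of "UNIV :: 's set"] by (auto simp: atLeast0LessThan)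
  have "power_sum_tensor k y = (\<lambda>is. \<Sum>i<CARD('s). tensor_pow k (y $ e i) is)"
    unfolding power_sum_tensor_def
    by (rule ext, rule sum.reindex_bij_betw[OF e, symmetric])
  then show ?thesis by (rule that)
qed

lemma ranks_eq_card:
  fixes y :: "complex ^ 'n::finite ^ 's::finite"
  assumes indep: "pairwise_lin_indep y" and nz: "\<And>i. y $ i \<noteq> 0" and k: "2 * CARD('s) \<le> k"
  shows "tensor_rank k (power_sum_tensor k y) = CARD('s)"
    and "sym_rank k (power_sum_tensor k y) = CARD('s)"
proof -
  obtain z where z: "power_sum_tensor k y = (\<lambda>is. \<Sum>i<CARD('s). tensor_pow k (z i) is)"
    by (rule power_sum_tensor_enumerated)
  note lower = card_le_decomposition_length[OF indep nz k]
  show "tensor_rank k (power_sum_tensor k y) = CARD('s)"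
    unfolding tensor_rank_def
  proof (rule Least_equality)
    show "\<exists>u. power_sum_tensor k y = (\<lambda>is. \<Sum>i<CARD('s). tensor_prod k (u i) is)"
      by (rule exI[of _ "\<lambda>i _. z i"]) (simp add: z tensor_pow_def)
  qed (auto dest: lower)
  show "sym_rank k (power_sum_tensor k y) = CARD('s)"
    unfolding sym_rank_def
  proof (rule Least_equality)
    show "\<exists>z. power_sum_tensor k y = (\<lambda>is. \<Sum>i<CARD('s). tensor_pow k (z i) is)"
      using z by blast
  qed (auto simp: tensor_pow_def dest: lower)
qed

lemma rank_zero: "tensor_rank k (\<lambda>_. 0) = 0" "sym_rank k (\<lambda>_. 0) = 0"
  unfolding tensor_rank_def sym_rank_def by (rule Least_equality; simp)+

text \<open>
  The zero vector is linearly dependent together with any other, so the family has no second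
  member; \<open>k > 0\<close> is needed because the empty product makes \<open>0\<^sup>\<otimes>\<^sup>0\<close> equal to one.
\<close>
lemma pairwise_lin_indep_zero:
  assumes indep: "pairwise_lin_indep y" and zero: "y $ i = 0" and k: "k > 0"
  shows "power_sum_tensor k y = (\<lambda>_. 0)"
proof -
  have "j = i" for j
    using indep zero vec.dependent_zero[of "{y $ i, y $ j}"]
    unfolding pairwise_lin_indep_def by (metis insertI1)
  then have "y $ j = 0" for j using zero by metis
  then show ?thesis
    using k by (auto simp: power_sum_tensor_def tensor_pow_def tensor_prod_def)
qed

theorem proposition5p4:
  "\<exists>k0. \<forall>k\<ge>k0. generically (\<lambda>y :: complex ^ 'n ^ 's.
     pairwise_lin_indep y \<longrightarrow>
       tensor_rank k (power_sum_tensor k y) = sym_rank k (power_sum_tensor k y))"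
proof (intro exI allI impI)
  fix k assume k: "2 * CARD('s) \<le> k"
  have "tensor_rank k (power_sum_tensor k y) = sym_rank k (power_sum_tensor k y)"
    if indep: "pairwise_lin_indep y" for y :: "complex ^ 'n ^ 's"
  proof (cases "\<exists>i. y $ i = 0")
    case True
    have "k > 0" using k zero_less_card_finite[where 'a = 's] by linarith
    with True indep have "power_sum_tensor k y = (\<lambda>_. 0)"
      using pairwise_lin_indep_zero by blast
    then show ?thesis by (simp add: rank_zero)
  next
    case False
    then show ?thesis using ranks_eq_card[OF indep _ k] by simp
  qed
  then show "generically (\<lambda>y :: complex ^ 'n ^ 's. pairwise_lin_indep y \<longrightarrow>
       tensor_rank k (power_sum_tensor k y) = sym_rank k (power_sum_tensor k y))"
    unfolding generically_def
    by (intro exI[of _ "\<lambda>_. 1"]) (simp add: polynomial_fun.const)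
qed

end
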